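(* Let $r\in\mathbb{R}^2$ be a root, $t_1,\dots,t_n\in\mathbb{R}^2$ terminals, and let $\alpha<\pi/2$ be a restricting angle. The length of an optimal flux tree $T$ for this input is at most $O((\sec(\alpha)+\csc(\alpha))\log n)$ times the length of the minimum spanning tree on the same set of terminals. Also, for every point $p\in T$, $d^T(p)\le \sec(\alpha)\,d(p)$.
   Context: The root $r$ is placed at the origin. A curve directed towards $r$ is angle-restricted if at every point $p\neq r$ of it the angle between the tangent vector of the curve at $p$ (in the direction of travel) and the vector from $p$ to $r$ is at most $\alpha$. A flux tree (angle-restricted Steiner arborescence) for root $r$ and terminals $t_1,\dots,t_n$ is a tree drawn in the plane, rooted at $r$, whose nodes include $r$ and all terminals and possibly additional (Steiner) nodes, and whose arcs are curves directed from the terminals towards the root, all of them angle-restricted. Its length is the sum of the lengths of its arcs; an optimal flux tree is one of minimum length. For a point $p\in T$, $d^T(p)$ denotes the distance between $p$ and $r$ in $T$ (the length of the path from $p$ to $r$ along $T$), and $d(p)$ denotes the Euclidean distance between $p$ and $r$. The minimum spanning tree is with respect to Euclidean distance.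
   Formalization: The minimum spanning tree is taken on the terminals together with the root (without the root the bound fails for two close terminals far from r); the length bound is for n ≥ 2, since log 1 = 0; and α > 0 is assumed so that csc(α) is defined. *)

theory Defs
  imports "HOL-Analysis.Analysis"
begin

section \<open>Curves\<close>

text \<open>The value for a zero vector is not meaningful; it is never used below.\<close>

definition vangle :: "'a::real_inner \<Rightarrow> 'a \<Rightarrow> real" where
  "vangle u v = arccos (inner u v / (norm u * norm v))"

text \<open>
  A curve is a regular path \<open>\<gamma> : [0,1] \<rightarrow> \<real>\<^sup>2\<close>, the tangent at an endpoint being one-sided.
  Differentiability is required only away from \<open>r\<close>, since a logarithmic spiral has no
  tangent at its centre. Corners may occur at the nodes of a tree.
\<close>

definition angle_restricted :: "'a::real_inner \<Rightarrow> real \<Rightarrow> (real \<Rightarrow> 'a) \<Rightarrow> bool" where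
  "angle_restricted r \<alpha> \<gamma> \<longleftrightarrow>
     path \<gamma> \<and>
     (\<forall>s\<in>{0..1}. \<gamma> s \<noteq> r \<longrightarrow>
        (\<exists>u. u \<noteq> 0 \<and> (\<gamma> has_vector_derivative u) (at s within {0..1}) \<and>
             vangle u (r - \<gamma> s) \<le> \<alpha>))"

text \<open>Supremum of the lengths of the polygons inscribed in \<open>\<gamma>\<close> restricted to \<open>[a,b]\<close>.\<close>

definition curve_length :: "(real \<Rightarrow> 'a::metric_space) \<Rightarrow> real \<Rightarrow> real \<Rightarrow> ennreal" where
  "curve_length \<gamma> a b =
     (SUP xs \<in> {xs. sorted xs \<and> set xs \<subseteq> {a..b}}.
        ennreal (\<Sum>i\<in>{1..<length xs}. dist (\<gamma> (xs ! (i - 1))) (\<gamma> (xs ! i))))"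

section \<open>Flux trees\<close>

text \<open>
  Nodes are points of the plane. In a tree directed towards its root every node \<open>v\<close> other
  than the root has exactly one outgoing arc; it ends at \<open>parent v\<close> and is drawn as the
  curve \<open>drawing v\<close>. The fields \<open>parent\<close> and \<open>drawing\<close> are irrelevant elsewhere.
  The definition does not forbid crossings of arcs.
\<close>

record 'a flux_tree =
  nodes :: "'a set"
  parent :: "'a \<Rightarrow> 'a"
  drawing :: "'a \<Rightarrow> real \<Rightarrow> 'a"

definition is_flux_tree ::
  "'a::real_inner \<Rightarrow> 'a set \<Rightarrow> real \<Rightarrow> 'a flux_tree \<Rightarrow> bool" where
  "is_flux_tree r P \<alpha> T \<longleftrightarrow>
     finite (nodes T) \<and> r \<in> nodes T \<and> P \<subseteq> nodes T \<and>
     (\<forall>v\<in>nodes T - {r}.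
        parent T v \<in> nodes T \<and>
        (\<exists>k. (parent T ^^ k) v = r) \<and>
        pathstart (drawing T v) = v \<and> pathfinish (drawing T v) = parent T v \<and>
        angle_restricted r \<alpha> (drawing T v))"

definition flux_length :: "'a::metric_space \<Rightarrow> 'a flux_tree \<Rightarrow> ennreal" where
  "flux_length r T = (\<Sum>v\<in>nodes T - {r}. curve_length (drawing T v) 0 1)"

definition optimal_flux_tree ::
  "'a::real_inner \<Rightarrow> 'a set \<Rightarrow> real \<Rightarrow> 'a flux_tree \<Rightarrow> bool" where
  "optimal_flux_tree r P \<alpha> T \<longleftrightarrow>
     is_flux_tree r P \<alpha> T \<and>
     (\<forall>T'. is_flux_tree r P \<alpha> T' \<longrightarrow> flux_length r T \<le> flux_length r T')"

definition node_tree_dist :: "'a::metric_space \<Rightarrow> 'a flux_tree \<Rightarrow> 'a \<Rightarrow> ennreal" where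
  "node_tree_dist r T v =
     (\<Sum>i<(LEAST k. (parent T ^^ k) v = r). curve_length (drawing T ((parent T ^^ i) v)) 0 1)"

text \<open>
  \<open>has_tree_dist r T p d\<close>: the point \<open>p\<close> lies on \<open>T\<close> and \<open>d\<close> is the length of the path
  from \<open>p\<close> along \<open>T\<close> to \<open>r\<close>. This is a relation rather than a function of \<open>p\<close> because in
  a tree with crossings \<open>p\<close> may lie on several arcs, each with its own path to \<open>r\<close>.
\<close>

definition has_tree_dist ::
  "'a::metric_space \<Rightarrow> 'a flux_tree \<Rightarrow> 'a \<Rightarrow> ennreal \<Rightarrow> bool" where
  "has_tree_dist r T p d \<longleftrightarrow>
     (p = r \<and> d = 0) \<or>
     (\<exists>v\<in>nodes T - {r}. \<exists>s\<in>{0..1}.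
        p = drawing T v s \<and>
        d = curve_length (drawing T v) s 1 + node_tree_dist r T (parent T v))"

section \<open>Euclidean minimum spanning trees\<close>

text \<open>
  Undirected edges are two-element sets, so the length of an edge is its diameter.
\<close>

definition spanning_tree :: "'a set \<Rightarrow> 'a set set \<Rightarrow> bool" where
  "spanning_tree P E \<longleftrightarrow>
     E \<subseteq> {{u, v} |u v. u \<in> P \<and> v \<in> P \<and> u \<noteq> v} \<and>
     (\<forall>u\<in>P. \<forall>v\<in>P. (u, v) \<in> {(x, y). {x, y} \<in> E}\<^sup>*) \<and>
     \<not> (\<exists>xs. 3 \<le> length xs \<and> distinct xs \<and>
            (\<forall>i<length xs. {xs ! i, xs ! (Suc i mod length xs)} \<in> E))"

definition edges_length :: "'a::metric_space set set \<Rightarrow> real" where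
  "edges_length E = (\<Sum>e\<in>E. diameter e)"

definition minimum_spanning_tree :: "'a::metric_space set \<Rightarrow> 'a set set \<Rightarrow> bool" where
  "minimum_spanning_tree P E \<longleftrightarrow>
     spanning_tree P E \<and> (\<forall>E'. spanning_tree P E' \<longrightarrow> edges_length E \<le> edges_length E')"

end

theory Submission
  imports Defs
begin

text \<open>
  Along an angle-restricted curve the distance to \<open>r\<close> decreases at least at rate \<open>cos \<alpha>\<close>, so the
  length of the curve is at most \<open>sec \<alpha>\<close> times the decrease; summed over a path to the root this
  is the distance bound.

  For the length bound, order the terminals along a walk of length at most twice the spanning tree
  and lift the walk to logarithmic polar coordinates \<open>(\<rho>, \<theta>)\<close>. There a logarithmic spiral is a
  segment, and \<open>z\<close> can be connected to \<open>w\<close> whenever \<open>cot \<alpha> * \<bar>\<theta>\<^sub>z - \<theta>\<^sub>w\<bar> \<le> \<rho>\<^sub>z - \<rho>\<^sub>w\<close>, a lattice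
  order. The infimum (join point) of a sublist whose walk has length \<open>L\<close> is closer to \<open>r\<close> than any member of the
  sublist by only \<open>(2 + \<pi> cot \<alpha>) L\<close>, so connecting it costs \<open>O((sec \<alpha> + csc \<alpha>) L)\<close>.
  Halving the walk recursively and connecting the join points of the halves to that of the whole
  spends \<open>O((sec \<alpha> + csc \<alpha>) L)\<close> on each of \<open>O(log n)\<close> levels.
\<close>

section \<open>Lengths of angle-restricted curves\<close>

text \<open>Turns the angle condition into an inequality free of \<open>arccos\<close>: by
  Cauchy-Schwarz the quotient lies in [-1, 1], where \<open>cos\<close> undoes
  \<open>arccos\<close>.\<close>

lemma vangle_le_imp_inner_ge:
  assumes "u \<noteq> 0" "v \<noteq> 0" "0 \<le> \<alpha>" "\<alpha> \<le> pi" "vangle u v \<le> \<alpha>"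
  shows "cos \<alpha> * (norm u * norm v) \<le> inner u v"
proof -
  let ?z = "inner u v / (norm u * norm v)"
  have "\<bar>?z\<bar> \<le> 1"
    using Cauchy_Schwarz_ineq2[of u v] assms by (simp add: abs_mult)
  then have z: "-1 \<le> ?z" "?z \<le> 1"
    by linarith+
  have "cos \<alpha> \<le> cos (arccos ?z)"
    using assms z arccos_lbound[of ?z] unfolding vangle_def by (intro cos_monotone_0_pi_le) auto
  also have "\<dots> = ?z"
    using z by simp
  finally show ?thesis
    using assms by (simp add: field_simps)
qed

text \<open>The rate is minus the component of \<open>u\<close> towards \<open>r\<close>, the
  quantity that the angle condition bounds from below.\<close>

lemma has_real_derivative_dist_const:
  fixes \<gamma> :: "real \<Rightarrow> 'a::real_inner"
  assumes "(\<gamma> has_vector_derivative u) (at x)" "\<gamma> x \<noteq> r"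
  shows "((\<lambda>x. dist (\<gamma> x) r) has_real_derivative - (inner u (r - \<gamma> x) / dist (\<gamma> x) r)) (at x)"
proof -
  have 1: "((\<lambda>x. \<gamma> x - r) has_derivative (\<lambda>h. h *\<^sub>R u)) (at x)"
    using assms(1) unfolding has_vector_derivative_def by (auto intro!: derivative_eq_intros)
  have 2: "(norm has_derivative (\<lambda>h. inner h (sgn (\<gamma> x - r)))) (at (\<gamma> x - r))"
    using assms(2) by (intro has_derivative_norm) auto
  have "((\<lambda>x. norm (\<gamma> x - r)) has_derivative (\<lambda>h. inner (h *\<^sub>R u) (sgn (\<gamma> x - r)))) (at x)"
    by (rule has_derivative_compose[OF 1 2])
  moreover have "(\<lambda>h. inner (h *\<^sub>R u) (sgn (\<gamma> x - r))) = (*) (- (inner u (r - \<gamma> x) / norm (\<gamma> x - r)))"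
    by (rule ext) (simp add: sgn_div_norm dist_norm inner_diff_right field_simps norm_minus_commute diff_divide_distrib)
  ultimately show ?thesis
    unfolding has_field_derivative_def dist_norm by (simp only:)
qed

text \<open>The estimate says that \<open>\<langle>\<gamma>, e\<rangle> + dist \<gamma> r / cos \<alpha>\<close> decreases for every unit vector \<open>e\<close>.\<close>

lemma angle_restricted_dist_le_off_root:
  assumes ar: "angle_restricted r \<alpha> \<gamma>" and \<alpha>: "0 < \<alpha>" "\<alpha> < pi / 2"
    and st: "0 \<le> s" "s \<le> t" "t \<le> 1" and off: "\<And>x. s < x \<Longrightarrow> x < t \<Longrightarrow> \<gamma> x \<noteq> r"
  shows "dist (\<gamma> s) (\<gamma> t) \<le> 1 / cos \<alpha> * (dist (\<gamma> s) r - dist (\<gamma> t) r)"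
proof -
  have cos: "cos \<alpha> > 0"
    using \<alpha> by (intro cos_gt_zero) auto
  have key: "inner (\<gamma> t - \<gamma> s) e \<le> 1 / cos \<alpha> * (dist (\<gamma> s) r - dist (\<gamma> t) r)"
    if e: "norm e \<le> 1" for e
  proof -
    define g where "g x = inner (\<gamma> x) e + 1 / cos \<alpha> * dist (\<gamma> x) r" for x
    have cont: "continuous_on {s..t} \<gamma>"
      using ar st by (auto simp: angle_restricted_def path_def intro: continuous_on_subset)
    have "g s \<ge> g t"
    proof (rule DERIV_nonpos_imp_decreasing_open[OF st(2)])
      show "continuous_on {s..t} g"
        unfolding g_def by (intro continuous_intros cont)
      fix x assume x: "s < x" "x < t"
      have nr: "\<gamma> x \<noteq> r"
        using off x by auto
      have "x \<in> {0..1}"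
        using x st by auto
      then obtain u where u: "u \<noteq> 0" "(\<gamma> has_vector_derivative u) (at x within {0..1})"
          "vangle u (r - \<gamma> x) \<le> \<alpha>"
        using ar nr unfolding angle_restricted_def by blast
      have "at x within {0..1} = at x"
        using x st by (intro at_within_interior) auto
      with u have d: "(\<gamma> has_vector_derivative u) (at x)"
        by simp
      have dpos: "dist (\<gamma> x) r > 0"
        using nr by simp
      have "((\<lambda>x. inner (\<gamma> x) e) has_real_derivative inner u e) (at x)"
        using d unfolding has_field_derivative_def has_vector_derivative_def
        by (auto intro!: derivative_eq_intros simp: fun_eq_iff)
      then have "(g has_real_derivative
          inner u e + 1 / cos \<alpha> * (- (inner u (r - \<gamma> x) / dist (\<gamma> x) r))) (at x)"
        unfolding g_def using has_real_derivative_dist_const[OF d nr]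
        by (intro DERIV_add DERIV_cmult)
      \<comment> \<open>The speed bounds the drift in direction \<open>e\<close>, and the angle
        condition bounds the speed by \<open>1 / cos \<alpha>\<close> times the rate of approach to
        \<open>r\<close>.\<close>
      moreover have "inner u e \<le> norm u"
        using norm_cauchy_schwarz[of u e] e mult_left_mono[OF e norm_ge_zero[of u]] by simp
      moreover have "norm u \<le> 1 / cos \<alpha> * (inner u (r - \<gamma> x) / dist (\<gamma> x) r)"
        using vangle_le_imp_inner_ge[OF u(1) _ _ _ u(3)] nr \<alpha> cos dpos
        by (simp add: dist_norm norm_minus_commute field_simps)
      ultimately show "\<exists>y. (g has_real_derivative y) (at x) \<and> y \<le> 0"
        by (intro exI conjI) auto
    qed
    then show ?thesis
      by (simp add: g_def algebra_simps)
  qed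
  \<comment> \<open>The unit vector along the chord recovers the distance. If the endpoints
    coincide, \<open>sgn\<close> gives 0, which is why \<open>key\<close> asks only for
    \<open>norm e \<le> 1\<close>.\<close>
  have "dist (\<gamma> s) (\<gamma> t) = inner (\<gamma> t - \<gamma> s) (sgn (\<gamma> t - \<gamma> s))"
    by (cases "\<gamma> s = \<gamma> t")
      (simp_all add: dist_norm norm_minus_commute sgn_div_norm dot_square_norm power2_eq_square)
  also have "\<dots> \<le> 1 / cos \<alpha> * (dist (\<gamma> s) r - dist (\<gamma> t) r)"
    by (intro key) (simp add: norm_sgn)
  finally show ?thesis .
qed

text \<open>No tangent is available at \<open>r\<close>, so the interval is cut at the first visit
  \<open>a\<close> and the last visit \<open>b\<close> to \<open>r\<close>; the previous estimate
  applies before \<open>a\<close> and after \<open>b\<close>.\<close>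

lemma angle_restricted_dist_le:
  assumes ar: "angle_restricted r \<alpha> \<gamma>" and \<alpha>: "0 < \<alpha>" "\<alpha> < pi / 2"
    and st: "0 \<le> s" "s \<le> t" "t \<le> 1"
  shows "dist (\<gamma> s) (\<gamma> t) \<le> 1 / cos \<alpha> * (dist (\<gamma> s) r - dist (\<gamma> t) r)"
proof -
  have cos: "cos \<alpha> > 0"
    using \<alpha> by (intro cos_gt_zero) auto
  define Z where "Z = {x \<in> {s..t}. \<gamma> x = r}"
  have "continuous_on {s..t} \<gamma>"
    using ar st by (auto simp: angle_restricted_def path_def intro: continuous_on_subset)
  then have "closed Z"
    unfolding Z_def using continuous_closed_preimage_constant[of "{s..t}" \<gamma> r] by simp
  moreover have "Z \<subseteq> {s..t}"
    by (auto simp: Z_def)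
  ultimately have cpt: "compact Z"
    unfolding compact_eq_bounded_closed
    using bounded_subset[OF bounded_closed_interval] by blast
  show ?thesis
  proof (cases "Z = {}")
    case True
    then show ?thesis
      using angle_restricted_dist_le_off_root[OF ar \<alpha> st] by (auto simp: Z_def)
  next
    case False
    obtain a where a: "a \<in> Z" "\<And>x. x \<in> Z \<Longrightarrow> a \<le> x"
      using compact_attains_inf[OF cpt False] by blast
    obtain b where b: "b \<in> Z" "\<And>x. x \<in> Z \<Longrightarrow> x \<le> b"
      using compact_attains_sup[OF cpt False] by blast
    have 1: "dist (\<gamma> s) (\<gamma> a) \<le> 1 / cos \<alpha> * (dist (\<gamma> s) r - dist (\<gamma> a) r)"
    proof (rule angle_restricted_dist_le_off_root[OF ar \<alpha>])
      show "\<gamma> x \<noteq> r" if "s < x" "x < a" for x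
        using a(2)[of x] that \<open>a \<in> Z\<close> by (auto simp: Z_def)
    qed (use a(1) st in \<open>auto simp: Z_def\<close>)
    \<comment> \<open>A curve that starts at \<open>r\<close> would have to decrease a distance that
      is already 0, so it is still at \<open>r\<close> at time \<open>t\<close>.\<close>
    have "dist (\<gamma> b) (\<gamma> t) \<le> 1 / cos \<alpha> * (dist (\<gamma> b) r - dist (\<gamma> t) r)"
    proof (rule angle_restricted_dist_le_off_root[OF ar \<alpha>])
      show "\<gamma> x \<noteq> r" if "b < x" "x < t" for x
        using b(2)[of x] that \<open>b \<in> Z\<close> by (auto simp: Z_def)
    qed (use b(1) st in \<open>auto simp: Z_def\<close>)
    also have "\<dots> \<le> 0"
      using b cos by (simp add: Z_def)
    finally have "\<gamma> t = \<gamma> a"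
      using a b by (simp add: Z_def)
    with 1 show ?thesis by simp
  qed
qed

text \<open>The bound for a chord is a difference of two values of one decreasing function, so the
  sum over any inscribed polygon telescopes.\<close>

lemma curve_length_angle_restricted_le:
  assumes ar: "angle_restricted r \<alpha> \<gamma>" and \<alpha>: "0 < \<alpha>" "\<alpha> < pi / 2"
    and ab: "0 \<le> a" "a \<le> b" "b \<le> 1"
  shows "curve_length \<gamma> a b \<le> ennreal (1 / cos \<alpha> * (dist (\<gamma> a) r - dist (\<gamma> b) r))"
  unfolding curve_length_def
proof (rule SUP_least, rule ennreal_leI)
  fix xs :: "real list" assume "xs \<in> {xs. sorted xs \<and> set xs \<subseteq> {a..b}}"
  then have xs: "sorted xs" "set xs \<subseteq> {a..b}" by auto
  let ?f = "\<lambda>x. 1 / cos \<alpha> * dist (\<gamma> x) r"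
  have cos: "cos \<alpha> > 0"
    using \<alpha> by (intro cos_gt_zero) auto
  have mono: "dist (\<gamma> x) (\<gamma> y) \<le> ?f x - ?f y" if "a \<le> x" "x \<le> y" "y \<le> b" for x y
    using angle_restricted_dist_le[OF ar \<alpha>, of x y] that ab by (simp add: algebra_simps diff_divide_distrib)
  have anti: "?f y \<le> ?f x" if "a \<le> x" "x \<le> y" "y \<le> b" for x y
    using mono[OF that] zero_le_dist[of "\<gamma> x" "\<gamma> y"] by linarith
  have rng: "a \<le> xs ! i" "xs ! i \<le> b" if "i < length xs" for i
    using xs(2) nth_mem[OF that] by auto
  have "(\<Sum>i\<in>{1..<length xs}. dist (\<gamma> (xs ! (i - 1))) (\<gamma> (xs ! i)))
      \<le> (\<Sum>i\<in>{1..<length xs}. ?f (xs ! (i - 1)) - ?f (xs ! i))"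
    using xs(1) by (intro sum_mono mono rng sorted_nth_mono) auto
  also have "\<dots> \<le> ?f a - ?f b"
  proof (cases "xs = []")
    case True
    then show ?thesis
      using anti[of a b] ab by simp
  next
    case False
    then obtain n where n: "length xs = Suc n"
      by (cases xs) auto
    have "(\<Sum>i\<in>{1..<length xs}. ?f (xs ! (i - 1)) - ?f (xs ! i))
        = (\<Sum>i<n. ?f (xs ! i) - ?f (xs ! Suc i))"
      by (rule sum.reindex_bij_witness[of _ Suc "\<lambda>i. i - 1"]) (auto simp: n)
    also have "\<dots> = ?f (xs ! 0) - ?f (xs ! n)"
      by (rule sum_lessThan_telescope')
    also have "\<dots> \<le> ?f a - ?f b"
      using anti[of a "xs ! 0"] anti[of "xs ! n" b] rng[of 0] rng[of n] n by linarith
    finally show ?thesis .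
  qed
  finally show "(\<Sum>i\<in>{1..<length xs}. dist (\<gamma> (xs ! (i - 1))) (\<gamma> (xs ! i)))
      \<le> 1 / cos \<alpha> * (dist (\<gamma> a) r - dist (\<gamma> b) r)"
    by (simp add: algebra_simps diff_divide_distrib)
qed

section \<open>Distance to the root along the tree\<close>

lemma node_tree_dist_le:
  assumes T: "is_flux_tree r P \<alpha> T" and \<alpha>: "0 < \<alpha>" "\<alpha> < pi / 2" and v: "v \<in> nodes T"
  shows "node_tree_dist r T v \<le> ennreal (1 / cos \<alpha> * dist v r)"
proof -
  let ?x = "\<lambda>i. (parent T ^^ i) v"
  let ?f = "\<lambda>x. 1 / cos \<alpha> * dist x r"
  \<comment> \<open>At the first visit to \<open>r\<close> all earlier nodes differ from
    \<open>r\<close>, so each of them has an angle-restricted outgoing arc.\<close>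
  define K where "K = (LEAST k. ?x k = r)"
  have cos: "cos \<alpha> > 0"
    using \<alpha> by (intro cos_gt_zero) auto
  have "\<exists>k. ?x k = r"
  proof (cases "v = r")
    case True
    then have "?x 0 = r" by simp
    then show ?thesis by blast
  next
    case False
    then show ?thesis
      using T v by (auto simp: is_flux_tree_def)
  qed
  then have K: "?x K = r"
    unfolding K_def by (rule LeastI_ex)
  have nr: "?x i \<noteq> r" if "i < K" for i
    using not_less_Least that unfolding K_def by blast
  have nodes: "?x i \<in> nodes T" if "i \<le> K" for i
    using that
  proof (induction i)
    case (Suc i)
    then show ?case
      using T nr[of i] by (auto simp: is_flux_tree_def)
  qed (use v in simp)
  \<comment> \<open>The second conjunct makes the summands nonnegative, so that
    \<open>ennreal\<close> can be moved out of the telescoping sum.\<close>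
  have arc: "curve_length (drawing T (?x i)) 0 1 \<le> ennreal (?f (?x i) - ?f (?x (Suc i)))
      \<and> ?f (?x (Suc i)) \<le> ?f (?x i)" if "i < K" for i
  proof -
    have "?x i \<in> nodes T - {r}"
      using nodes nr that by auto
    then have *: "angle_restricted r \<alpha> (drawing T (?x i))"
        "drawing T (?x i) 0 = ?x i" "drawing T (?x i) 1 = ?x (Suc i)"
      using T by (auto simp: is_flux_tree_def pathstart_def pathfinish_def)
    have "0 \<le> 1 / cos \<alpha> * (dist (?x i) r - dist (?x (Suc i)) r)"
      using angle_restricted_dist_le[OF *(1) \<alpha>, of 0 1] *(2,3)
      by (metis order.trans zero_le_dist order.refl zero_le_one)
    then show ?thesis
      using curve_length_angle_restricted_le[OF *(1) \<alpha>, of 0 1] * by (simp add: algebra_simps diff_divide_distrib)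
  qed
  have "node_tree_dist r T v \<le> (\<Sum>i<K. ennreal (?f (?x i) - ?f (?x (Suc i))))"
    unfolding node_tree_dist_def K_def[symmetric] using arc by (intro sum_mono) auto
  also have "\<dots> = ennreal (\<Sum>i<K. ?f (?x i) - ?f (?x (Suc i)))"
    using arc by (intro sum_ennreal) (simp add: diff_ge_0_iff_ge)
  also have "(\<Sum>i<K. ?f (?x i) - ?f (?x (Suc i))) = ?f (?x 0) - ?f (?x K)"
    by (rule sum_lessThan_telescope')
  also have "\<dots> = ?f v"
    using K by simp
  finally show ?thesis .
qed

text \<open>The rest of the arc from \<open>p\<close> to the next node costs at most
  \<open>1 / cos \<alpha>\<close> times the decrease of the distance to \<open>r\<close>, the path
  from that node at most \<open>1 / cos \<alpha>\<close> times the remaining distance.\<close>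

lemma has_tree_dist_le:
  assumes T: "is_flux_tree r P \<alpha> T" and \<alpha>: "0 < \<alpha>" "\<alpha> < pi / 2" and d: "has_tree_dist r T p d"
  shows "d \<le> ennreal (1 / cos \<alpha> * dist p r)"
  using d unfolding has_tree_dist_def
proof (elim disjE bexE conjE)
  have cos: "cos \<alpha> > 0"
    using \<alpha> by (intro cos_gt_zero) auto
  fix v s assume v: "v \<in> nodes T - {r}" and s: "s \<in> {0..1}" and p: "p = drawing T v s"
    and d: "d = curve_length (drawing T v) s 1 + node_tree_dist r T (parent T v)"
  let ?q = "parent T v"
  have *: "angle_restricted r \<alpha> (drawing T v)" "drawing T v 1 = ?q" "?q \<in> nodes T"
    using T v by (auto simp: is_flux_tree_def pathfinish_def)
  have "0 \<le> 1 / cos \<alpha> * (dist p r - dist ?q r)"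
    using angle_restricted_dist_le[OF *(1) \<alpha>, of s 1] *(2) s p
    by (metis order.trans zero_le_dist order.refl atLeastAtMost_iff)
  moreover have "d \<le> ennreal (1 / cos \<alpha> * (dist p r - dist ?q r)) + ennreal (1 / cos \<alpha> * dist ?q r)"
    using curve_length_angle_restricted_le[OF *(1) \<alpha>, of s 1] node_tree_dist_le[OF T \<alpha> *(3)] *(2) s
    unfolding d p by (intro add_mono) auto
  moreover have "0 \<le> 1 / cos \<alpha> * dist ?q r"
    using cos by simp
  ultimately show ?thesis
    by (simp add: ennreal_plus[symmetric] algebra_simps diff_divide_distrib del: ennreal_plus)
qed simp

section \<open>Elementary estimates for angles and sines\<close>

text \<open>Converse of \<open>vangle_le_imp_inner_ge\<close>, for checking that constructed curves
  are angle-restricted.\<close>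

lemma inner_ge_imp_vangle_le:
  assumes "u \<noteq> 0" "v \<noteq> 0" "0 \<le> \<alpha>" "\<alpha> \<le> pi" "cos \<alpha> * (norm u * norm v) \<le> inner u v"
  shows "vangle u v \<le> \<alpha>"
proof -
  let ?z = "inner u v / (norm u * norm v)"
  have "\<bar>?z\<bar> \<le> 1"
    using Cauchy_Schwarz_ineq2[of u v] assms by (simp add: abs_mult)
  then have z: "-1 \<le> ?z" "?z \<le> 1"
    by linarith+
  have "cos \<alpha> \<le> ?z"
    using assms by (simp add: field_simps)
  then have "arccos ?z \<le> arccos (cos \<alpha>)"
    using z by (intro arccos_le_arccos) auto
  then show ?thesis
    using assms by (simp add: vangle_def arccos_cos)
qed

text \<open>Jordan's inequality: a concave function lies above the chord between the ends of its
  interval.\<close>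

lemma sin_ge_chord:
  fixes x :: real
  assumes "0 \<le> x" "x \<le> pi / 2"
  shows "2 / pi * x \<le> sin x"
proof -
  have "concave_on {0..pi/2} (sin :: real \<Rightarrow> real)"
  proof (rule f''_le0_imp_concave)
    show "(sin has_real_derivative cos x) (at x)" for x :: real
      by (rule DERIV_sin)
    show "(cos has_real_derivative - sin x) (at x)" for x :: real
      by (rule DERIV_cos)
    show "- sin x \<le> 0" if "x \<in> {0..pi/2}" for x :: real
      using that sin_ge_zero[of x] pi_gt_zero by auto
  qed auto
  from concave_onD[OF this, of "2 / pi * x" 0 "pi / 2"] show ?thesis
    using assms by (simp add: field_simps)
qed

section \<open>Logarithmic polar coordinates\<close>

text \<open>The complex exponential translated to \<open>r\<close>. Angles are not reduced modulo
  \<open>2 * pi\<close>, so this is the universal covering of the plane without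
  \<open>r\<close>.\<close>

definition log_polar :: "real^2 \<Rightarrow> real \<times> real \<Rightarrow> real^2" where
  "log_polar r z = r + exp (fst z) *\<^sub>R (cos (snd z) *\<^sub>R axis 1 1 + sin (snd z) *\<^sub>R axis 2 1)"

lemma inner_axis_combination:
  "inner (a *\<^sub>R axis 1 1 + b *\<^sub>R axis 2 1 :: real^2) (c *\<^sub>R axis 1 1 + d *\<^sub>R axis 2 1) = a * c + b * d"
  by (simp add: inner_add_left inner_add_right inner_axis_axis)

lemma norm_axis_combination: "norm (a *\<^sub>R axis 1 1 + b *\<^sub>R axis 2 1 :: real^2) = sqrt (a\<^sup>2 + b\<^sup>2)"
  by (simp only: norm_eq_sqrt_inner inner_axis_combination power2_eq_square)

lemma dist_log_polar_centre: "dist (log_polar r z) r = exp (fst z)"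
  by (simp add: dist_norm log_polar_def norm_axis_combination)

lemma log_polar_neq_centre: "log_polar r z \<noteq> r"
  using dist_log_polar_centre[of r z] by (metis dist_self exp_not_eq_zero)

lemma dist_log_polar_sq:
  "(dist (log_polar r (\<rho>, \<theta>)) (log_polar r (\<rho>', \<theta>')))\<^sup>2
     = (exp \<rho> - exp \<rho>')\<^sup>2 + 4 * exp \<rho> * exp \<rho>' * (sin ((\<theta> - \<theta>') / 2))\<^sup>2"
proof -
  have "log_polar r (\<rho>, \<theta>) - log_polar r (\<rho>', \<theta>')
      = (exp \<rho> * cos \<theta> - exp \<rho>' * cos \<theta>') *\<^sub>R axis 1 1 + (exp \<rho> * sin \<theta> - exp \<rho>' * sin \<theta>') *\<^sub>R axis 2 1"
    by (simp add: log_polar_def algebra_simps)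
  then have "(dist (log_polar r (\<rho>, \<theta>)) (log_polar r (\<rho>', \<theta>')))\<^sup>2
      = (exp \<rho> * cos \<theta> - exp \<rho>' * cos \<theta>')\<^sup>2 + (exp \<rho> * sin \<theta> - exp \<rho>' * sin \<theta>')\<^sup>2"
    by (simp add: dist_norm norm_axis_combination)
  also have "\<dots> = (exp \<rho>)\<^sup>2 * ((sin \<theta>)\<^sup>2 + (cos \<theta>)\<^sup>2) + (exp \<rho>')\<^sup>2 * ((sin \<theta>')\<^sup>2 + (cos \<theta>')\<^sup>2)
      - 2 * exp \<rho> * exp \<rho>' * cos (\<theta> - \<theta>')"
    unfolding cos_diff by algebra
  also have "cos (\<theta> - \<theta>') = 1 - 2 * (sin ((\<theta> - \<theta>') / 2))\<^sup>2"
    using cos_double_sin[of "(\<theta> - \<theta>') / 2"] by (metis field_sum_of_halves mult_2)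
  finally show ?thesis
    by (simp add: power2_diff algebra_simps)
qed

text \<open>Drop the radial summand of the squared distance and apply Jordan's inequality to the
  half angle, which is at most \<open>pi / 2\<close>.\<close>

lemma dist_angle_le_dist_log_polar:
  assumes m: "0 < m" "m \<le> exp (fst z)" "m \<le> exp (fst z')" and "\<bar>snd z - snd z'\<bar> \<le> pi"
  shows "dist (snd z) (snd z') \<le> pi / (2 * m) * dist (log_polar r z) (log_polar r z')"
proof -
  obtain \<rho> \<theta> \<rho>' \<theta>' where z: "z = (\<rho>, \<theta>)" "z' = (\<rho>', \<theta>')"
    by (metis surj_pair)
  let ?\<phi> = "\<bar>\<theta> - \<theta>'\<bar>" and ?d = "dist (log_polar r z) (log_polar r z')"
  have "2 / pi * (?\<phi> / 2) \<le> sin (?\<phi> / 2)"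
    using assms by (intro sin_ge_chord) (auto simp: z)
  then have "(?\<phi> / pi)\<^sup>2 \<le> (sin (?\<phi> / 2))\<^sup>2"
    by (intro power_mono) auto
  also have "(sin (?\<phi> / 2))\<^sup>2 = (sin ((\<theta> - \<theta>') / 2))\<^sup>2"
  proof (cases "0 \<le> \<theta> - \<theta>'")
    case False
    have "sin ((\<theta>' - \<theta>) / 2) = - sin ((\<theta> - \<theta>') / 2)"
      by (metis minus_diff_eq minus_divide_left sin_minus)
    with False show ?thesis by simp
  qed simp
  finally have "m * m * (?\<phi> / pi)\<^sup>2 \<le> exp \<rho> * exp \<rho>' * (sin ((\<theta> - \<theta>') / 2))\<^sup>2"
    using m by (intro mult_mono) (auto simp: z)
  moreover have "(2 * m * ?\<phi> / pi)\<^sup>2 = 4 * (m * m * (?\<phi> / pi)\<^sup>2)"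
    by (simp add: power2_eq_square)
  ultimately have "(2 * m * ?\<phi> / pi)\<^sup>2 \<le> 4 * exp \<rho> * exp \<rho>' * (sin ((\<theta> - \<theta>') / 2))\<^sup>2"
    by linarith
  also have "\<dots> \<le> ?d\<^sup>2"
    unfolding z dist_log_polar_sq by simp
  finally have "2 * m * ?\<phi> / pi \<le> ?d"
    by (rule power2_le_imp_le) simp
  then show ?thesis
    using m by (simp add: z dist_real_def field_simps)
qed

text \<open>The freedom to choose the angle near a given \<theta>\<open>\<^sub>0\<close> is what
  lets a walk be lifted with bounded angular steps.\<close>

lemma ex_log_polar:
  assumes "p \<noteq> r"
  shows "\<exists>\<rho> \<theta>. \<bar>\<theta> - \<theta>\<^sub>0\<bar> \<le> pi \<and> log_polar r (\<rho>, \<theta>) = p"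
proof -
  define R where "R = dist p r"
  have R: "R > 0"
    using assms by (simp add: R_def)
  define v where "v = (1 / R) *\<^sub>R (p - r)"
  have v: "v = v$1 *\<^sub>R axis 1 1 + v$2 *\<^sub>R axis 2 1"
    by (simp add: vec_eq_iff forall_2 axis_def)
  have "norm v = 1"
    using R by (simp add: v_def R_def dist_norm)
  then have "(v$1)\<^sup>2 + (v$2)\<^sup>2 = 1"
    by (metis v norm_axis_combination real_sqrt_eq_1_iff)
  then obtain t where t: "v$1 = cos t" "v$2 = sin t"
    using sincos_total_2pi by metis
  \<comment> \<open>Rounding to the nearest number of full turns leaves an error of at most half a
    turn.\<close>
  define k where "k = round ((\<theta>\<^sub>0 - t) / (2 * pi))"
  define \<theta> where "\<theta> = t + 2 * pi * of_int k"
  have "\<bar>of_int k - (\<theta>\<^sub>0 - t) / (2 * pi)\<bar> \<le> 1/2"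
    unfolding k_def by (rule of_int_round_abs_le)
  then have "\<bar>\<theta> - \<theta>\<^sub>0\<bar> \<le> pi"
    unfolding \<theta>_def using pi_gt_zero by (simp add: abs_le_iff field_simps)
  moreover have "cos \<theta> = cos t" "sin \<theta> = sin t"
    unfolding \<theta>_def cos_add sin_add sin_int_2pin cos_int_2pin by simp_all
  then have "log_polar r (ln R, \<theta>) = r + R *\<^sub>R v"
    using R t v by (simp add: log_polar_def)
  then have "log_polar r (ln R, \<theta>) = p"
    using R by (simp add: v_def)
  ultimately show ?thesis by blast
qed

text \<open>The image is a logarithmic spiral: its velocity makes a constant angle with the
  direction to \<open>r\<close>, of cosine \<open>- a / sqrt (a\<^sup>2 + b\<^sup>2)\<close>, and
  the hypothesis says that this is at least \<open>cos \<alpha>\<close>.\<close>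

lemma log_polar_segment_angle_restricted:
  assumes \<alpha>: "0 < \<alpha>" "\<alpha> < pi / 2"
    and ne: "(\<rho>, \<theta>) \<noteq> (\<rho>', \<theta>')" and le: "cos \<alpha> * \<bar>\<theta> - \<theta>'\<bar> \<le> sin \<alpha> * (\<rho> - \<rho>')"
  shows "angle_restricted r \<alpha> (\<lambda>s. log_polar r (\<rho> + s * (\<rho>' - \<rho>), \<theta> + s * (\<theta>' - \<theta>)))"
proof -
  have cos: "cos \<alpha> > 0" and sin: "sin \<alpha> > 0"
    using \<alpha> by (auto intro!: cos_gt_zero sin_gt_zero)
  have "0 \<le> sin \<alpha> * (\<rho> - \<rho>')"
    using le cos by (smt (verit) mult_nonneg_nonneg abs_ge_zero)
  then have "\<rho>' \<le> \<rho>"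
    using sin by (simp add: zero_le_mult_iff)
  \<comment> \<open>Equal radii would force equal angles and hence a constant curve.\<close>
  moreover have "\<rho> \<noteq> \<rho>'"
    using le ne cos by (auto simp: mult_le_0_iff)
  ultimately have lt: "\<rho>' < \<rho>" by simp
  define a b where "a = \<rho>' - \<rho>" and "b = \<theta>' - \<theta>"
  have a: "a < 0" and ab: "cos \<alpha> * \<bar>b\<bar> \<le> sin \<alpha> * (- a)"
    using lt le by (auto simp: a_def b_def abs_minus_commute)
  have "(cos \<alpha>)\<^sup>2 * b\<^sup>2 \<le> (sin \<alpha>)\<^sup>2 * a\<^sup>2"
    using power_mono[OF ab, of 2] cos by (simp add: power_mult_distrib)
  then have "(cos \<alpha>)\<^sup>2 * (a\<^sup>2 + b\<^sup>2) \<le> a\<^sup>2"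
    by (simp add: sin_squared_eq algebra_simps)
  then have cosab: "cos \<alpha> * sqrt (a\<^sup>2 + b\<^sup>2) \<le> - a"
    using real_sqrt_le_mono[of "(cos \<alpha>)\<^sup>2 * (a\<^sup>2 + b\<^sup>2)" "a\<^sup>2"] a cos by (simp add: real_sqrt_mult)
  define \<gamma> where "\<gamma> = (\<lambda>s. log_polar r (\<rho> + s * a, \<theta> + s * b))"
  \<comment> \<open>In complex notation this is \<open>(a + i b)\<close> times the exponential of
    the current point of the segment.\<close>
  define u where "u s = exp (\<rho> + s * a) *\<^sub>R ((a * cos (\<theta> + s * b) - b * sin (\<theta> + s * b)) *\<^sub>R axis 1 1
      + (a * sin (\<theta> + s * b) + b * cos (\<theta> + s * b)) *\<^sub>R axis 2 1 :: real^2)" for s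
  have der: "(\<gamma> has_vector_derivative u s) (at s within S)" for s S
    unfolding \<gamma>_def log_polar_def u_def fst_conv snd_conv
    by (auto intro!: derivative_eq_intros simp: algebra_simps)
  have "angle_restricted r \<alpha> \<gamma>"
    unfolding angle_restricted_def
  proof (intro conjI ballI impI)
    show "path \<gamma>"
      unfolding path_def using der
      by (meson continuous_at_imp_continuous_on has_vector_derivative_continuous)
    fix s :: real
    have *: "(a * c - b * d) * (- c) + (a * d + b * c) * (- d) = - a * (c\<^sup>2 + d\<^sup>2)"
      "(a * c - b * d)\<^sup>2 + (a * d + b * c)\<^sup>2 = (a\<^sup>2 + b\<^sup>2) * (c\<^sup>2 + d\<^sup>2)" for c d :: real
      by (simp_all add: power2_eq_square algebra_simps)
    have rg: "r - \<gamma> s = exp (\<rho> + s * a) *\<^sub>R ((- cos (\<theta> + s * b)) *\<^sub>R axis 1 1 + (- sin (\<theta> + s * b)) *\<^sub>R axis 2 1)"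
      by (simp add: \<gamma>_def log_polar_def algebra_simps)
    have nu: "norm (u s) = exp (\<rho> + s * a) * sqrt (a\<^sup>2 + b\<^sup>2)"
      unfolding u_def norm_scaleR norm_axis_combination * by simp
    have nr: "norm (r - \<gamma> s) = exp (\<rho> + s * a)"
      unfolding rg norm_scaleR norm_axis_combination by simp
    have inn: "inner (u s) (r - \<gamma> s) = (exp (\<rho> + s * a))\<^sup>2 * (- a)"
      unfolding rg u_def inner_scaleR_left inner_scaleR_right inner_axis_combination * by (simp add: power2_eq_square)
    have "a\<^sup>2 + b\<^sup>2 > 0"
      using a by (simp add: sum_power2_gt_zero_iff)
    then have "norm (u s) \<noteq> 0" "norm (r - \<gamma> s) \<noteq> 0"
      unfolding nu nr by auto
    then have u0: "u s \<noteq> 0" "r - \<gamma> s \<noteq> 0" by auto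
    have "(exp (\<rho> + s * a))\<^sup>2 * (cos \<alpha> * sqrt (a\<^sup>2 + b\<^sup>2)) \<le> (exp (\<rho> + s * a))\<^sup>2 * (- a)"
      by (intro mult_left_mono cosab) auto
    then have "cos \<alpha> * (norm (u s) * norm (r - \<gamma> s)) \<le> inner (u s) (r - \<gamma> s)"
      unfolding nu nr inn by (simp add: power2_eq_square mult_ac)
    then have "vangle (u s) (r - \<gamma> s) \<le> \<alpha>"
      using u0 \<alpha> by (intro inner_ge_imp_vangle_le) auto
    then show "\<exists>u. u \<noteq> 0 \<and> (\<gamma> has_vector_derivative u) (at s within {0..1}) \<and> vangle u (r - \<gamma> s) \<le> \<alpha>"
      using der u0 by blast
  qed
  then show ?thesis
    by (simp add: \<gamma>_def a_def b_def)
qed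

section \<open>Walks\<close>

fun walk :: "'a::metric_space list \<Rightarrow> real" where
  "walk (x # y # xs) = dist x y + walk (y # xs)"
| "walk _ = 0"

lemma walk_nonneg: "0 \<le> walk xs"
  by (induction xs rule: walk.induct) auto

lemma dist_hd_le_walk: "y \<in> set (x # xs) \<Longrightarrow> dist x y \<le> walk (x # xs)"
proof (induction xs arbitrary: x)
  case (Cons z xs)
  show ?case
  proof (cases "y = x")
    case False
    then have "dist z y \<le> walk (z # xs)"
      using Cons by auto
    then show ?thesis
      using dist_triangle[of x y z] by simp
  qed (use walk_nonneg[of "x # z # xs"] in simp)
qed simp

lemma dist_le_walk: "x \<in> set xs \<Longrightarrow> y \<in> set xs \<Longrightarrow> dist x y \<le> walk xs"
proof (induction xs)
  case (Cons z xs)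
  show ?case
  proof (cases "x = z \<or> y = z")
    case True
    then show ?thesis
      using Cons.prems dist_hd_le_walk[of _ z xs] by (auto simp: dist_commute)
  next
    case False
    then have "dist x y \<le> walk xs"
      using Cons by auto
    also have "\<dots> \<le> walk (z # xs)"
      by (cases xs) auto
    finally show ?thesis .
  qed
qed simp

text \<open>Only the edge between the two lists is lost. This bounds the total length of the walks
  on one level of the halving.\<close>

lemma walk_append_ge: "walk xs + walk ys \<le> walk (xs @ ys)"
proof (induction xs rule: walk.induct)
  case ("2_2" v)
  then show ?case by (cases ys) auto
qed auto

lemma walk_Cons_ge: "walk xs \<le> walk (x # xs)"
  by (cases xs) auto

text \<open>Going to \<open>v\<close> costs \<open>dist u v\<close>, and continuing from
  \<open>v\<close> costs at most \<open>dist u v\<close> more than continuing from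
  \<open>u\<close>.\<close>

lemma walk_insert_le: "walk (xs @ u # v # ys) \<le> walk (xs @ u # ys) + 2 * dist u v"
proof (induction xs rule: walk.induct)
  case "2_1"
  then show ?case
    using dist_triangle[of v "hd ys" u] by (cases ys) (auto simp: dist_commute)
next
  case ("2_2" x)
  then show ?case
    using dist_triangle[of v "hd ys" u] by (cases ys) (auto simp: dist_commute)
qed auto

lemma diameter_doubleton: "diameter {u, v} = dist u v"
proof (rule antisym)
  obtain x y where "x \<in> {u, v}" "y \<in> {u, v}" "dist x y = diameter {u, v}"
    using diameter_compact_attained[OF finite_imp_compact, of "{u, v}"] by blast
  then show "diameter {u, v} \<le> dist u v"
    by (auto simp: dist_commute)
  show "dist u v \<le> diameter {u, v}"
    by (rule diameter_bounded_bound) auto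
qed

text \<open>Grow the list along tree edges: a vertex inserted directly behind its neighbour
  lengthens the walk by at most twice the length of the new edge.\<close>

lemma connected_edges_imp_short_walk:
  fixes r :: "'a::metric_space"
  assumes fin: "finite P" and r: "r \<in> P"
    and E: "E \<subseteq> {{u, v} |u v. u \<in> P \<and> v \<in> P \<and> u \<noteq> v}"
    and conn: "\<forall>u\<in>P. \<forall>v\<in>P. (u, v) \<in> {(x, y). {x, y} \<in> E}\<^sup>*"
  shows "\<exists>ys. set (r # ys) = P \<and> distinct (r # ys) \<and> walk (r # ys) \<le> 2 * edges_length E"
proof -
  have finE: "finite E"
    using E fin by (auto intro: finite_subset[of _ "Pow P"])
  \<comment> \<open>\<open>F\<close> collects the edges used so far. They lie inside the current
    list, so an edge leaving the list is new and its length is counted once.\<close>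
  have "\<exists>ys F. distinct (r # ys) \<and> set (r # ys) \<subseteq> P \<and> length (r # ys) = Suc k \<and> F \<subseteq> E
      \<and> \<Union>F \<subseteq> set (r # ys) \<and> walk (r # ys) \<le> 2 * edges_length F" if "Suc k \<le> card P" for k
    using that
  proof (induction k)
    case 0
    show ?case
      using r by (intro exI[of _ "[]"] exI[of _ "{}"]) (simp add: edges_length_def)
  next
    case (Suc k)
    then obtain ys F where *: "distinct (r # ys)" "set (r # ys) \<subseteq> P" "length (r # ys) = Suc k"
        "F \<subseteq> E" "\<Union>F \<subseteq> set (r # ys)" "walk (r # ys) \<le> 2 * edges_length F"
      by auto
    let ?A = "set (r # ys)"
    have "card ?A = Suc k"
      using *(1,3) distinct_card by metis
    then have "?A \<noteq> P"
      using Suc.prems by auto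
    then obtain w where w: "w \<in> P" "w \<notin> ?A"
      using *(2) by blast
    have "(r, w) \<in> {(x, y). {x, y} \<in> E}\<^sup>*"
      using conn r w by blast
    \<comment> \<open>A path from \<open>r\<close> to a vertex outside the list must leave the list
      along some edge.\<close>
    then have "\<exists>u v. u \<in> ?A \<and> v \<notin> ?A \<and> {u, v} \<in> E"
      using w(2)
    proof (induction rule: rtrancl_induct)
      case (step y z)
      then show ?case by (cases "y \<in> ?A") auto
    qed simp
    then obtain u v where uv: "u \<in> ?A" "v \<notin> ?A" "{u, v} \<in> E"
      by blast
    have "v \<in> P"
      using uv(3) E by (auto simp: doubleton_eq_iff)
    have "finite F"
      using *(4) finE finite_subset by blast
    moreover have "{u, v} \<notin> F"
      using uv(2) *(5) by auto
    ultimately have len: "edges_length (insert {u, v} F) = dist u v + edges_length F"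
      by (simp add: edges_length_def diameter_doubleton)
    obtain as bs where ab: "r # ys = as @ u # bs"
      using split_list[OF uv(1)] by auto
    \<comment> \<open>Inserting behind \<open>u\<close> keeps \<open>r\<close> at the head.\<close>
    obtain zs where zs: "as @ u # v # bs = r # zs"
      using ab by (cases as) auto
    have set: "set (r # zs) = insert v ?A"
      unfolding zs[symmetric] ab by auto
    show ?case
    proof (intro exI conjI)
      show "distinct (r # zs)"
        using *(1) uv(2) unfolding zs[symmetric] ab by auto
      show "length (r # zs) = Suc (Suc k)"
        using *(3) unfolding zs[symmetric] ab by auto
      show "walk (r # zs) \<le> 2 * edges_length (insert {u, v} F)"
        using *(6) walk_insert_le[of as u v bs] unfolding zs ab[symmetric] len by simp
      show "\<Union> (insert {u, v} F) \<subseteq> set (r # zs)"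
        using *(5) uv(1) unfolding set by auto
      show "insert {u, v} F \<subseteq> E"
        using *(4) uv(3) by simp
      show "set (r # zs) \<subseteq> P"
        using *(2) \<open>v \<in> P\<close> unfolding set by simp
    qed
  qed
  moreover have "Suc (card P - 1) = card P"
    using r fin card_gt_0_iff[of P] by auto
  ultimately obtain ys F where *: "distinct (r # ys)" "set (r # ys) \<subseteq> P"
      "length (r # ys) = card P" "F \<subseteq> E" "walk (r # ys) \<le> 2 * edges_length F"
    by (metis order_refl)
  have "set (r # ys) = P"
    using * fin by (intro card_subset_eq) (auto simp: distinct_card[of "r # ys"] simp del: distinct.simps set_simps)
  moreover have "edges_length F \<le> edges_length E"
    unfolding edges_length_def using finE *(4) E
    by (intro sum_mono2) (auto intro!: diameter_ge_0)
  ultimately show ?thesis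
    using *(1,5) by (intro exI[of _ ys]) auto
qed

section \<open>Extending flux trees\<close>

text \<open>Hides the tree behind the points reached and a bound on the cost. Both can be weakened,
  so trees can be grown one point at a time.\<close>

definition flux_spans :: "'a::real_inner \<Rightarrow> real \<Rightarrow> 'a set \<Rightarrow> real \<Rightarrow> bool" where
  "flux_spans r \<alpha> Q l \<longleftrightarrow> (\<exists>T. is_flux_tree r Q \<alpha> T \<and> flux_length r T \<le> ennreal l)"

lemma flux_spans_mono: "flux_spans r \<alpha> Q l \<Longrightarrow> Q' \<subseteq> Q \<Longrightarrow> l \<le> l' \<Longrightarrow> flux_spans r \<alpha> Q' l'"
  unfolding flux_spans_def is_flux_tree_def
  by (meson ennreal_leI order_trans)

lemma flux_spans_root: "flux_spans r \<alpha> {r} 0"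
  unfolding flux_spans_def
  \<comment> \<open>With \<open>r\<close> as the only node there is no arc, so the values of
    \<open>parent\<close> and \<open>drawing\<close> are dummies.\<close>
  by (intro exI[of _ "\<lparr>nodes = {r}, parent = id, drawing = \<lambda>_ _. r\<rparr>"])
    (simp add: is_flux_tree_def flux_length_def)

text \<open>Hang \<open>p\<close> on \<open>q\<close> by the arc \<gamma>. If \<open>p\<close> is
  already a node, the old tree serves; otherwise no old node has \<open>p\<close> as its parent, so
  old paths to \<open>r\<close> persist.\<close>

lemma flux_spans_insert:
  assumes Q: "flux_spans r \<alpha> Q l" and q: "q \<in> insert r Q"
    and \<gamma>: "angle_restricted r \<alpha> \<gamma>" "\<gamma> 0 = p" "\<gamma> 1 = q" "curve_length \<gamma> 0 1 \<le> ennreal c"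
    and nn: "0 \<le> l" "0 \<le> c"
  shows "flux_spans r \<alpha> (insert p Q) (l + c)"
proof -
  obtain T where T: "is_flux_tree r Q \<alpha> T" and len: "flux_length r T \<le> ennreal l"
    using Q by (auto simp: flux_spans_def)
  show ?thesis
  proof (cases "p \<in> nodes T")
    case True
    then have "is_flux_tree r (insert p Q) \<alpha> T"
      using T by (simp add: is_flux_tree_def)
    moreover have "flux_length r T \<le> ennreal (l + c)"
      using len nn ennreal_leI[of l "l + c"] by (meson order_trans le_add_same_cancel1)
    ultimately show ?thesis
      by (auto simp: flux_spans_def)
  next
    case False
    define T' where "T' = \<lparr>nodes = insert p (nodes T), parent = (parent T)(p := q), drawing = (drawing T)(p := \<gamma>)\<rparr>"
    have rT: "r \<in> nodes T" and fin: "finite (nodes T)" and qT: "q \<in> nodes T"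
      using T q by (auto simp: is_flux_tree_def)
    have iter: "\<exists>k. (parent T' ^^ k) v = r" if "v \<in> nodes T" for v
    proof -
      have "\<exists>k. (parent T ^^ k) v = r"
      proof (cases "v = r")
        case True
        then have "(parent T ^^ 0) v = r" by simp
        then show ?thesis by blast
      qed (use T that in \<open>auto simp: is_flux_tree_def\<close>)
      then obtain k where "(parent T ^^ k) v = r" by blast
      then show ?thesis
        using that
      proof (induction k arbitrary: v)
        case 0
        then have "(parent T' ^^ 0) v = r" by simp
        then show ?case by blast
      next
        case (Suc k)
        show ?case
        \<comment> \<open>The field \<open>parent\<close> is arbitrary at \<open>r\<close>, so the
          iteration must stop as soon as it meets \<open>r\<close>.\<close>
        proof (cases "v = r")
          case True
          then have "(parent T' ^^ 0) v = r" by simp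
          then show ?thesis by blast
        next
          case 2: False
          have "parent T v \<in> nodes T"
            using T Suc.prems 2 by (auto simp: is_flux_tree_def)
          moreover have "(parent T ^^ k) (parent T v) = r"
            using Suc.prems(1) by (simp add: funpow_swap1)
          ultimately obtain j where "(parent T' ^^ j) (parent T v) = r"
            using Suc.IH by blast
          moreover have "parent T' v = parent T v"
            using False Suc.prems by (auto simp: T'_def)
          ultimately have "(parent T' ^^ Suc j) v = r"
            by (simp add: funpow_swap1)
          then show ?thesis by blast
        qed
      qed
    qed
    obtain j where "(parent T' ^^ j) q = r"
      using iter qT by blast
    then have "(parent T' ^^ Suc j) p = r"
      unfolding funpow_Suc_right by (simp add: T'_def)
    then have iter': "\<exists>k. (parent T' ^^ k) v = r" if "v \<in> nodes T'" for v
      using iter that by (cases "v = p") (auto simp: T'_def simp del: funpow.simps)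
    have "is_flux_tree r (insert p Q) \<alpha> T'"
      unfolding is_flux_tree_def
    proof (intro conjI ballI)
      fix v assume v: "v \<in> nodes T' - {r}"
      then show "\<exists>k. (parent T' ^^ k) v = r"
        using iter' by simp
      have *: "v = p \<or> v \<in> nodes T - {r} \<and> v \<noteq> p"
        using v by (auto simp: T'_def)
      show "parent T' v \<in> nodes T'" "pathstart (drawing T' v) = v"
        "pathfinish (drawing T' v) = parent T' v" "angle_restricted r \<alpha> (drawing T' v)"
        using * T \<gamma> qT by (auto simp: is_flux_tree_def T'_def pathstart_def pathfinish_def)
    qed (use T in \<open>auto simp: is_flux_tree_def T'_def\<close>)
    moreover have "flux_length r T' \<le> ennreal (l + c)"
    proof -
      have "nodes T' - {r} = insert p (nodes T - {r})"
        using False rT by (auto simp: T'_def)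
      then have "flux_length r T' = curve_length \<gamma> 0 1 + (\<Sum>v\<in>nodes T - {r}. curve_length (drawing T' v) 0 1)"
        using False fin by (simp add: flux_length_def T'_def)
      also have "(\<Sum>v\<in>nodes T - {r}. curve_length (drawing T' v) 0 1) = flux_length r T"
        unfolding flux_length_def using False by (intro sum.cong) (auto simp: T'_def)
      also have "curve_length \<gamma> 0 1 + flux_length r T \<le> ennreal c + ennreal l"
        using \<gamma>(4) len by (intro add_mono)
      also have "\<dots> = ennreal (l + c)"
        using nn by (simp add: add.commute)
      finally show ?thesis .
    qed
    ultimately show ?thesis
      by (auto simp: flux_spans_def)
  qed
qed

section \<open>The domination order of the lifted plane\<close>

text \<open>With \<open>c = cot \<alpha>\<close> this is the product order in the coordinates \<open>u = \<rho> - c \<theta>\<close> and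
  \<open>v = \<rho> + c \<theta>\<close> of the universal cover of the punctured plane. The point where curves from all
  points of \<open>Z\<close> can first meet, called \<open>join\<close> below, is the infimum for this order.\<close>

definition below :: "real \<Rightarrow> real \<times> real \<Rightarrow> real \<times> real \<Rightarrow> bool" where
  "below c w z \<longleftrightarrow> c * \<bar>snd z - snd w\<bar> \<le> fst z - fst w"

definition join :: "real \<Rightarrow> (real \<times> real) set \<Rightarrow> real \<times> real" where
  "join c Z =
    (let u = Min ((\<lambda>z. fst z - c * snd z) ` Z); v = Min ((\<lambda>z. fst z + c * snd z) ` Z)
     in ((u + v) / 2, (v - u) / (2 * c)))"

lemma below_iff:
  "0 < c \<Longrightarrow> below c w z \<longleftrightarrow>
    fst w - c * snd w \<le> fst z - c * snd z \<and> fst w + c * snd w \<le> fst z + c * snd z"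
proof -
  assume c: "0 < c"
  have "c * \<bar>snd z - snd w\<bar> = \<bar>c * snd z - c * snd w\<bar>"
    using c by (simp add: abs_mult flip: right_diff_distrib)
  then show ?thesis
    unfolding below_def by (simp only:) linarith
qed

lemma below_imp_fst_le: "0 < c \<Longrightarrow> below c w z \<Longrightarrow> fst w \<le> fst z"
  by (auto simp: below_iff)

lemma join_coords:
  assumes "0 < c"
  shows "fst (join c Z) - c * snd (join c Z) = Min ((\<lambda>z. fst z - c * snd z) ` Z)"
    and "fst (join c Z) + c * snd (join c Z) = Min ((\<lambda>z. fst z + c * snd z) ` Z)"
  using assms by (simp_all add: join_def Let_def field_simps)

lemma join_below:
  assumes "0 < c" "finite Z" "z \<in> Z"
  shows "below c (join c Z) z"
  using assms by (simp add: below_iff join_coords)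

lemma join_below_join:
  assumes "0 < c" "finite Z" "Y \<subseteq> Z" "Y \<noteq> {}"
  shows "below c (join c Z) (join c Y)"
  using assms by (simp add: below_iff join_coords Min_antimono image_mono)

lemma join_singleton: "0 < c \<Longrightarrow> join c {z} = z"
  by (simp add: join_def prod_eq_iff)

lemma le_Min_image: "finite A \<Longrightarrow> x \<in> A \<Longrightarrow> (\<And>y. y \<in> A \<Longrightarrow> b \<le> f y) \<Longrightarrow> b \<le> Min (f ` A)"
  by (subst Min_ge_iff) auto

section \<open>How much closer to the root the join of a walk is\<close>

text \<open>The comparison is made for consecutive points only, since the angle estimate needs steps
  of at most \<open>pi\<close>.\<close>

lemma walk_map_le:
  assumes "successively (\<lambda>x y. dist (f x) (f y) \<le> K * dist (g x) (g y)) zs"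
  shows "walk (map f zs) \<le> K * walk (map g zs)"
  using assms by (induction zs rule: induct_list012) (auto simp: algebra_simps)

text \<open>If the walk is short compared with the distance to \<open>r\<close>, all its points have about the
  same radius and their angles differ by at most \<open>\<pi>\<close> times the ratio; otherwise there is
  nothing to show.\<close>

lemma exp_join_ge:
  assumes c: "0 < c" and steps: "successively (\<lambda>z z'. \<bar>snd z - snd z'\<bar> \<le> pi) zs"
    and x: "x \<in> set zs"
  shows "exp (fst x) - exp (fst (join c (set zs))) \<le> (2 + c * pi) * walk (map (log_polar r) zs)"
proof -
  define R L where "R = exp (fst x)" and "L = walk (map (log_polar r) zs)"
  have L0: "0 \<le> L"
    unfolding L_def by (rule walk_nonneg)
  have R0: "0 < R"
    by (simp add: R_def)
  show ?thesis
  proof (cases "R \<le> (2 + c * pi) * L")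
    case True
    then show ?thesis
      using exp_gt_zero[of "fst (join c (set zs))"] unfolding R_def L_def by linarith
  next
    case False
    have "0 \<le> c * pi * L"
      using c L0 by simp
    moreover have "(2 + c * pi) * L = 2 * L + c * pi * L"
      by algebra
    ultimately have LR: "L \<le> R / 2" "L < R"
      using False R0 by linarith+
    have rad: "R - L \<le> exp (fst z)" if "z \<in> set zs" for z
    proof -
      have "dist (log_polar r x) (log_polar r z) \<le> L"
        unfolding L_def using x that by (intro dist_le_walk) auto
      moreover have "dist (log_polar r x) r \<le> dist (log_polar r x) (log_polar r z) + dist (log_polar r z) r"
        by (rule dist_triangle)
      ultimately show ?thesis
        unfolding dist_log_polar_centre R_def by linarith
    qed
    \<comment> \<open>All radii are at least \<open>R - L \<ge> R / 2\<close>, so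
      \<open>R / 2\<close> serves as their common lower bound.\<close>
    have "successively (\<lambda>z z'. dist (snd z) (snd z')
        \<le> pi / (2 * (R / 2)) * dist (log_polar r z) (log_polar r z')) zs"
      using steps
    proof (rule successively_mono)
      fix z z' assume zz: "z \<in> set zs" "z' \<in> set zs" "\<bar>snd z - snd z'\<bar> \<le> pi"
      show "dist (snd z) (snd z') \<le> pi / (2 * (R / 2)) * dist (log_polar r z) (log_polar r z')"
        using rad[OF zz(1)] rad[OF zz(2)] LR R0 zz(3) by (intro dist_angle_le_dist_log_polar) auto
    qed
    then have "walk (map snd zs) \<le> pi / (2 * (R / 2)) * L"
      unfolding L_def by (rule walk_map_le)
    then have "walk (map snd zs) \<le> pi / R * L"
      by simp
    then have ang: "\<bar>snd x - snd z\<bar> \<le> pi / R * L" if "z \<in> set zs" for z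
      using dist_le_walk[of "snd x" "map snd zs" "snd z"] x that by (simp add: dist_real_def)
    define \<delta> where "\<delta> = pi / R * L"
    have cang: "c * \<bar>snd x - snd z\<bar> \<le> c * \<delta>" if "z \<in> set zs" for z
      using ang[OF that] c unfolding \<delta>_def by (intro mult_left_mono) auto
    have lnrad: "ln (R - L) \<le> fst z" if "z \<in> set zs" for z
      using ln_mono[OF rad[OF that]] LR by simp
    have coords: "ln (R - L) - c * snd x - c * \<delta> \<le> fst z - c * snd z"
      "ln (R - L) + c * snd x - c * \<delta> \<le> fst z + c * snd z" if "z \<in> set zs" for z
    proof -
      have "\<bar>c * snd x - c * snd z\<bar> \<le> c * \<delta>"
        using cang[OF that] c by (simp add: abs_mult flip: right_diff_distrib)
      then show "ln (R - L) - c * snd x - c * \<delta> \<le> fst z - c * snd z"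
        "ln (R - L) + c * snd x - c * \<delta> \<le> fst z + c * snd z"
        using lnrad[OF that] by linarith+
    qed
    let ?w = "join c (set zs)"
    \<comment> \<open>The coordinates of the join are minima and inherit the bounds; adding the two
      cancels \<open>c * snd x\<close>.\<close>
    have "ln (R - L) - c * snd x - c * \<delta> \<le> fst ?w - c * snd ?w"
      unfolding join_coords(1)[OF c] by (rule le_Min_image[OF finite_set x coords(1)])
    moreover have "ln (R - L) + c * snd x - c * \<delta> \<le> fst ?w + c * snd ?w"
      unfolding join_coords(2)[OF c] by (rule le_Min_image[OF finite_set x coords(2)])
    ultimately have "ln (R - L) - c * \<delta> \<le> fst ?w"
      by linarith
    then have "exp (ln (R - L) - c * \<delta>) \<le> exp (fst ?w)"
      by simp
    moreover have "exp (ln (R - L) - c * \<delta>) = (R - L) * exp (- (c * \<delta>))"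
      using LR(2) exp_ln[of "R - L"] mult_exp_exp[of "ln (R - L)" "- (c * \<delta>)"] by simp
    \<comment> \<open>The tangent bound \<open>1 + x \<le> exp x\<close> linearises the loss; in the
      expansion the term \<open>L * (c * \<delta>)\<close> is dropped.\<close>
    moreover have "(R - L) * (1 - c * \<delta>) \<le> (R - L) * exp (- (c * \<delta>))"
      using LR(2) exp_ge_add_one_self[of "- (c * \<delta>)"] by (intro mult_left_mono) simp_all
    ultimately have "(R - L) * (1 - c * \<delta>) \<le> exp (fst ?w)"
      by simp
    moreover have "(R - L) * (1 - c * \<delta>) = R - L - R * (c * \<delta>) + L * (c * \<delta>)"
      by (simp add: algebra_simps)
    moreover have "R * (c * \<delta>) = c * pi * L"
      using R0 by (simp add: \<delta>_def)
    moreover have "0 \<le> L * (c * \<delta>)"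
      using L0 c R0 by (simp add: \<delta>_def)
    ultimately have "R - exp (fst ?w) \<le> L + c * pi * L"
      by simp
    also have "\<dots> \<le> (2 + c * pi) * L"
      using L0 by (simp add: distrib_right)
    finally show ?thesis
      unfolding L_def R_def .
  qed
qed

section \<open>Lifting a walk to logarithmic polar coordinates\<close>

lemma ex_log_polar_lift:
  assumes "r \<notin> set ys"
  shows "\<exists>zs. map (log_polar r) zs = ys \<and> successively (\<lambda>z z'. \<bar>snd z - snd z'\<bar> \<le> pi) zs"
  using assms
proof (induction ys)
  case (Cons y ys)
  then obtain zs where zs: "map (log_polar r) zs = ys"
      "successively (\<lambda>z z'. \<bar>snd z - snd z'\<bar> \<le> pi) zs"
    by auto
  have "y \<noteq> r"
    using Cons.prems by auto
  \<comment> \<open>The list is lifted from its end, each new angle within \<open>pi\<close> of the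
    next. For the last point \<open>hd zs\<close> is unspecified, and any reference angle
    serves.\<close>
  from ex_log_polar[OF this, of "snd (hd zs)"] obtain \<rho> \<theta>
    where "\<bar>\<theta> - snd (hd zs)\<bar> \<le> pi" "log_polar r (\<rho>, \<theta>) = y"
    by blast
  with zs show ?case
    by (intro exI[of _ "(\<rho>, \<theta>) # zs"]) (auto simp: successively_Cons)
qed simp

section \<open>Attaching radial segments and spirals to a flux tree\<close>

text \<open>The velocity points straight at \<open>r\<close>, so the angle is 0. This curve is
  needed to reach \<open>r\<close>, which has no logarithmic polar coordinates.\<close>

lemma segment_to_root_angle_restricted:
  assumes "0 \<le> \<alpha>" "\<alpha> \<le> pi"
  shows "angle_restricted r \<alpha> (\<lambda>s. p + s *\<^sub>R (r - p))"
  unfolding angle_restricted_def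
proof (intro conjI ballI impI)
  show "path (\<lambda>s. p + s *\<^sub>R (r - p))"
    unfolding path_def by (intro continuous_intros)
  fix s :: real assume s: "s \<in> {0..1}" and ne: "p + s *\<^sub>R (r - p) \<noteq> r"
  have "s \<noteq> 1" "r - p \<noteq> 0"
    using ne by auto
  have eq: "r - (p + s *\<^sub>R (r - p)) = (1 - s) *\<^sub>R (r - p)"
    by (simp add: algebra_simps)
  have "vangle (r - p) ((1 - s) *\<^sub>R (r - p)) \<le> \<alpha>"
  proof (rule inner_ge_imp_vangle_le)
    have "cos \<alpha> * ((1 - s) * (norm (r - p))\<^sup>2) \<le> 1 * ((1 - s) * (norm (r - p))\<^sup>2)"
      using s by (intro mult_right_mono) auto
    then show "cos \<alpha> * (norm (r - p) * norm ((1 - s) *\<^sub>R (r - p))) \<le> inner (r - p) ((1 - s) *\<^sub>R (r - p))"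
      using s by (simp add: power2_norm_eq_inner[symmetric]) (simp add: power2_eq_square mult_ac)
  qed (use assms \<open>s \<noteq> 1\<close> \<open>r - p \<noteq> 0\<close> in auto)
  moreover have "((\<lambda>s. p + s *\<^sub>R (r - p)) has_vector_derivative r - p) (at s within {0..1})"
    by (auto intro!: derivative_eq_intros)
  ultimately show "\<exists>u. u \<noteq> 0 \<and> ((\<lambda>s. p + s *\<^sub>R (r - p)) has_vector_derivative u) (at s within {0..1})
      \<and> vangle u (r - (p + s *\<^sub>R (r - p))) \<le> \<alpha>"
    unfolding eq using \<open>r - p \<noteq> 0\<close> by blast
qed

text \<open>The new arc is priced by the distances of its ends from \<open>r\<close> alone.\<close>

lemma flux_spans_insert_angle_restricted:
  assumes \<alpha>: "0 < \<alpha>" "\<alpha> < pi / 2" and Q: "flux_spans r \<alpha> Q l" "0 \<le> l" "q \<in> insert r Q"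
    and \<gamma>: "angle_restricted r \<alpha> \<gamma>" "\<gamma> 0 = p" "\<gamma> 1 = q"
    and l': "l + 1 / cos \<alpha> * (dist p r - dist q r) \<le> l'"
  shows "flux_spans r \<alpha> (insert p Q) l'"
proof -
  have "0 \<le> 1 / cos \<alpha> * (dist p r - dist q r)"
    using angle_restricted_dist_le[OF \<gamma>(1) \<alpha>, of 0 1] \<gamma>(2,3)
    by (metis order.trans zero_le_dist order.refl zero_le_one)
  then have "flux_spans r \<alpha> (insert p Q) (l + 1 / cos \<alpha> * (dist p r - dist q r))"
    using curve_length_angle_restricted_le[OF \<gamma>(1) \<alpha>, of 0 1] \<gamma>(2,3) Q
    by (intro flux_spans_insert[OF Q(1,3) \<gamma>]) auto
  then show ?thesis
    using flux_spans_mono order_refl l' by blast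
qed

lemma flux_spans_insert_below:
  assumes \<alpha>: "0 < \<alpha>" "\<alpha> < pi / 2" and Q: "flux_spans r \<alpha> Q l" "0 \<le> l" "log_polar r w \<in> Q"
    and wz: "below (cos \<alpha> / sin \<alpha>) w z" and l': "l + 1 / cos \<alpha> * (exp (fst z) - exp (fst w)) \<le> l'"
  shows "flux_spans r \<alpha> (insert (log_polar r z) Q) l'"
\<comment> \<open>A constant segment has no nonzero tangent, so equal points are treated apart:
  nothing is added.\<close>
proof (cases "z = w")
  case True
  then show ?thesis
    using Q l' by (auto simp: insert_absorb intro: flux_spans_mono)
next
  case False
  have "sin \<alpha> > 0"
    using \<alpha> by (intro sin_gt_zero) auto
  then have "cos \<alpha> * \<bar>snd z - snd w\<bar> \<le> sin \<alpha> * (fst z - fst w)"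
    using wz by (simp add: below_def field_simps)
  then have ar: "angle_restricted r \<alpha>
      (\<lambda>s. log_polar r (fst z + s * (fst w - fst z), snd z + s * (snd w - snd z)))"
    using False by (intro log_polar_segment_angle_restricted[OF \<alpha>]) (auto simp: prod_eq_iff)
  show ?thesis
    using Q l' by (intro flux_spans_insert_angle_restricted[OF \<alpha> Q(1,2) _ ar, where q = "log_polar r w"])
      (simp_all add: dist_log_polar_centre)
qed

text \<open>Halving the list \<open>k\<close> times, the joins of the two halves are connected to the join of the
  whole; the walks of all lists on one level add up to at most the walk of \<open>zs\<close>.\<close>

lemma flux_spans_log_polar_walk:
  assumes \<alpha>: "0 < \<alpha>" "\<alpha> < pi / 2" and c: "c = cos \<alpha> / sin \<alpha>"
    and "zs \<noteq> []" "length zs \<le> 2 ^ k" "successively (\<lambda>z z'. \<bar>snd z - snd z'\<bar> \<le> pi) zs"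
    and "flux_spans r \<alpha> Q l" "0 \<le> l" "log_polar r (join c (set zs)) \<in> Q"
  shows "flux_spans r \<alpha> (Q \<union> log_polar r ` set zs)
           (l + 2 * (1 / cos \<alpha> * (2 + c * pi)) * walk (map (log_polar r) zs) * real k)"
  using assms(4-)
proof (induction k arbitrary: zs Q l)
  case 0
  have cpos: "0 < c"
    using \<alpha> unfolding c by (intro divide_pos_pos cos_gt_zero sin_gt_zero) auto
  obtain z where "zs = [z]"
    using 0 by (cases zs) auto
  then show ?case
    using 0 cpos by (simp add: join_singleton insert_absorb)
next
  case (Suc k)
  have cpos: "0 < c" and cos: "0 < cos \<alpha>"
    using \<alpha> unfolding c by (auto intro!: divide_pos_pos cos_gt_zero sin_gt_zero)
  define A where "A = 1 / cos \<alpha> * (2 + c * pi)"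
  have A: "0 \<le> A"
    using cos cpos by (simp add: A_def)
  let ?W = "\<lambda>zs. walk (map (log_polar r) zs)"
  show ?case
  proof (cases "length zs \<le> 2 ^ k")
    case True
    then have "flux_spans r \<alpha> (Q \<union> log_polar r ` set zs) (l + 2 * A * ?W zs * real k)"
      using Suc.IH[OF Suc.prems(1) True Suc.prems(3-)] unfolding A_def by simp
    moreover have "2 * A * ?W zs * real k \<le> 2 * A * ?W zs * real (Suc k)"
      using A walk_nonneg by (intro mult_left_mono mult_nonneg_nonneg) auto
    ultimately show ?thesis
      unfolding A_def[symmetric] by (elim flux_spans_mono) auto
  next
    case False
    \<comment> \<open>Cutting at \<open>2 ^ k\<close> leaves both parts no longer than that, and the
      second is nonempty because \<open>zs\<close> is longer.\<close>
    define xs ys where "xs = take (2 ^ k) zs" and "ys = drop (2 ^ k) zs"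
    have zs: "zs = xs @ ys"
      by (simp add: xs_def ys_def)
    have nonempty: "xs \<noteq> []" "ys \<noteq> []" and len: "length xs \<le> 2 ^ k" "length ys \<le> 2 ^ k"
      using False Suc.prems(1,2) by (auto simp: xs_def ys_def)
    have steps: "successively (\<lambda>z z'. \<bar>snd z - snd z'\<bar> \<le> pi) xs"
        "successively (\<lambda>z z'. \<bar>snd z - snd z'\<bar> \<le> pi) ys"
      using Suc.prems(3) unfolding zs by (auto simp: successively_append_iff)
    have W: "?W xs + ?W ys \<le> ?W zs" "0 \<le> ?W zs" "0 \<le> ?W xs" "0 \<le> ?W ys"
      using walk_append_ge[of "map (log_polar r) xs" "map (log_polar r) ys"]
      by (auto simp: zs intro: walk_nonneg)
    let ?w = "join c (set zs)"
    \<comment> \<open>The join of \<open>Y\<close> is no farther from \<open>r\<close> than a member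
      of \<open>Y\<close>, so the estimate for members applies to it.\<close>
    have cost: "1 / cos \<alpha> * (exp (fst (join c Y)) - exp (fst ?w)) \<le> A * ?W zs"
      if Y: "Y \<subseteq> set zs" "Y \<noteq> {}" for Y
    proof -
      obtain y where y: "y \<in> Y"
        using Y by blast
      have "finite Y"
        using Y finite_subset by blast
      then have "fst (join c Y) \<le> fst y"
        using below_imp_fst_le join_below cpos y by blast
      then have "exp (fst (join c Y)) - exp (fst ?w) \<le> (2 + c * pi) * ?W zs"
        using exp_join_ge[OF cpos Suc.prems(3), of y r] y Y by (smt (verit) exp_le_cancel_iff subsetD)
      then have "1 / cos \<alpha> * (exp (fst (join c Y)) - exp (fst ?w)) \<le> 1 / cos \<alpha> * ((2 + c * pi) * ?W zs)"
        using cos by (intro mult_left_mono) auto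
      then show ?thesis
        by (simp only: A_def mult.assoc)
    qed
    have AW: "0 \<le> A * ?W zs" "0 \<le> A * ?W xs" "0 \<le> A * ?W ys"
      using A W by auto
    have connect: "flux_spans r \<alpha> (insert (log_polar r (join c Y)) Q') (l' + A * ?W zs)"
      if Q': "flux_spans r \<alpha> Q' l'" "0 \<le> l'" "log_polar r ?w \<in> Q'" and Y: "Y \<subseteq> set zs" "Y \<noteq> {}" for Y Q' l'
    proof (rule flux_spans_insert_below[OF \<alpha> Q'])
      show "below (cos \<alpha> / sin \<alpha>) ?w (join c Y)"
        unfolding c[symmetric] using cpos Y by (intro join_below_join) auto
      show "l' + 1 / cos \<alpha> * (exp (fst (join c Y)) - exp (fst ?w)) \<le> l' + A * ?W zs"
        using cost[OF Y] by simp
    qed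
    have "flux_spans r \<alpha> (insert (log_polar r (join c (set xs))) Q) (l + A * ?W zs)"
      using nonempty zs by (intro connect Suc.prems(4-6)) auto
    then have "flux_spans r \<alpha> (insert (log_polar r (join c (set ys))) (insert (log_polar r (join c (set xs))) Q))
        (l + A * ?W zs + A * ?W zs)"
      by (rule connect) (use Suc.prems(5,6) AW nonempty zs in auto)
    then have "flux_spans r \<alpha> (insert (log_polar r (join c (set ys))) (insert (log_polar r (join c (set xs))) Q))
        (l + 2 * A * ?W zs)"
      by (simp add: algebra_simps)
    from Suc.IH[OF nonempty(1) len(1) steps(1) this]
    have "flux_spans r \<alpha> (insert (log_polar r (join c (set ys))) (insert (log_polar r (join c (set xs))) Q)
        \<union> log_polar r ` set xs) (l + 2 * A * ?W zs + 2 * A * ?W xs * real k)"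
      using Suc.prems(5) AW unfolding A_def[symmetric] by simp
    from Suc.IH[OF nonempty(2) len(2) steps(2) this]
    have "flux_spans r \<alpha> (insert (log_polar r (join c (set ys))) (insert (log_polar r (join c (set xs))) Q)
        \<union> log_polar r ` set xs \<union> log_polar r ` set ys)
        (l + 2 * A * ?W zs + 2 * A * ?W xs * real k + 2 * A * ?W ys * real k)"
      using Suc.prems(5) AW unfolding A_def[symmetric] by simp
    \<comment> \<open>The two new arcs account for one term \<open>2 * A * ?W zs\<close>; the walks
      of the halves add up to at most \<open>?W zs\<close>, so the deeper levels give
      \<open>k\<close> further terms.\<close>
    moreover have "l + 2 * A * ?W zs + 2 * A * ?W xs * real k + 2 * A * ?W ys * real k
        \<le> l + 2 * A * ?W zs * real (Suc k)"
      using mult_left_mono[OF W(1), of "2 * A * real k"] A by (simp add: algebra_simps)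
    ultimately show ?thesis
      unfolding A_def[symmetric] by (elim flux_spans_mono) (auto simp: zs)
  qed
qed

section \<open>The logarithmic bound\<close>

text \<open>The tree consists of a radial segment from the join of the lifted walk to
  \<open>r\<close> and of the spirals from the recursive halving.\<close>

lemma flux_spans_short:
  fixes r :: "real^2"
  assumes \<alpha>: "0 < \<alpha>" "\<alpha> < pi / 2" and n: "2 \<le> n" and P: "finite P" "card P \<le> n"
    and M: "spanning_tree (insert r P) M"
  shows "flux_spans r \<alpha> P (34 / ln 2 * (1 / cos \<alpha> + 1 / sin \<alpha>) * ln (real n) * edges_length M)"
proof -
  have cos: "0 < cos \<alpha>" and sin: "0 < sin \<alpha>"
    using \<alpha> by (auto intro!: cos_gt_zero sin_gt_zero)
  define c S m where "c = cos \<alpha> / sin \<alpha>" and "S = 1 / cos \<alpha> + 1 / sin \<alpha>" and "m = edges_length M"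
  have cpos: "0 < c" and S: "0 < S"
    using cos sin by (simp_all add: c_def S_def add_pos_pos)
  obtain ys where ys: "set (r # ys) = insert r P" "distinct (r # ys)" "walk (r # ys) \<le> 2 * m"
    using connected_edges_imp_short_walk[of "insert r P" r M] M P
    unfolding spanning_tree_def m_def by blast
  have m: "0 \<le> m"
    using ys(3) walk_nonneg[of "r # ys"] by linarith
  have bound: "0 \<le> 34 / ln 2 * S * ln (real n) * m"
    using S m n by simp
  show ?thesis
  proof (cases "ys = []")
    case True
    then have "P \<subseteq> {r}"
      using ys(1) by auto
    then show ?thesis
      using flux_spans_mono[OF flux_spans_root] bound unfolding S_def m_def by blast
  next
    case False
    have "r \<notin> set ys"
      using ys(2) by auto
    then obtain zs where zs: "map (log_polar r) zs = ys"
        "successively (\<lambda>z z'. \<bar>snd z - snd z'\<bar> \<le> pi) zs"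
      using ex_log_polar_lift by blast
    define w where "w = join c (set zs)"
    have ne: "zs \<noteq> []"
      using False zs(1) by auto
    \<comment> \<open>The join is no farther from \<open>r\<close> than the first terminal visited,
      and the walk starts at \<open>r\<close>, so the radius of the join is at most the length of
      the walk.\<close>
    have "below c w (hd zs)"
      unfolding w_def using ne cpos by (intro join_below) auto
    then have "exp (fst w) \<le> exp (fst (hd zs))"
      using below_imp_fst_le cpos by simp
    also have "\<dots> = dist r (hd ys)"
      unfolding zs(1)[symmetric] using ne dist_log_polar_centre[of r "hd zs"] by (simp add: hd_map dist_commute)
    also have "\<dots> \<le> walk (r # ys)"
      using False by (intro dist_hd_le_walk) auto
    finally have wm: "exp (fst w) \<le> 2 * m"
      using ys(3) by linarith
    have "flux_spans r \<alpha> {log_polar r w, r} (1 / cos \<alpha> * exp (fst w))"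
      using \<alpha> by (intro flux_spans_insert_angle_restricted[OF \<alpha> flux_spans_root _ _
            segment_to_root_angle_restricted[of \<alpha> r "log_polar r w"], where q = r])
        (simp_all add: dist_log_polar_centre)
    \<comment> \<open>Since \<open>n \<ge> 2\<close> the binary logarithm is at least 1, so rounding
      up at most doubles it.\<close>
    define k where "k = nat \<lceil>log 2 (real n)\<rceil>"
    have log: "1 \<le> log 2 (real n)"
      using n by (simp add: le_log_iff)
    have "length zs \<le> 2 ^ k"
    proof -
      have "Suc (length ys) \<le> Suc (card P)"
        using ys(1,2) P card_insert_le_m1 distinct_card[of "r # ys"] by (metis card_insert_if length_Cons le_SucI order_refl)
      then have "length zs \<le> n"
        using P zs(1) by (metis Suc_le_mono le_trans length_map)
      moreover have "real n \<le> 2 ^ k"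
      proof -
        have "real n = 2 powr log 2 (real n)"
          using n by simp
        also have "\<dots> \<le> 2 powr real k"
          unfolding k_def using log by (intro powr_mono) (auto simp: of_nat_ceiling)
        finally show ?thesis
          by (simp add: powr_realpow)
      qed
      ultimately show ?thesis
        by (metis le_trans of_nat_le_iff of_nat_numeral of_nat_power)
    qed
    let ?A = "1 / cos \<alpha> * (2 + c * pi)"
    from flux_spans_log_polar_walk[OF \<alpha> c_def ne \<open>length zs \<le> 2 ^ k\<close> zs(2)
        \<open>flux_spans r \<alpha> {log_polar r w, r} (1 / cos \<alpha> * exp (fst w))\<close>]
    have "flux_spans r \<alpha> ({log_polar r w, r} \<union> set ys)
        (1 / cos \<alpha> * exp (fst w) + 2 * ?A * walk ys * real k)"
      using cos unfolding w_def zs(1)[symmetric] by simp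
    moreover have "P \<subseteq> {log_polar r w, r} \<union> set ys"
      using ys(1) by auto
    moreover have "1 / cos \<alpha> * exp (fst w) + 2 * ?A * walk ys * real k \<le> 34 / ln 2 * S * ln (real n) * m"
    proof -
      \<comment> \<open>Here \<open>c / cos \<alpha> = 1 / sin \<alpha>\<close>, which is how the
        cosecant enters; 4 bounds both 2 and \<open>pi\<close>.\<close>
      have "?A = 2 * (1 / cos \<alpha>) + pi * (1 / sin \<alpha>)"
        using cos sin by (simp add: c_def field_simps)
      also have "\<dots> \<le> 4 * (1 / cos \<alpha>) + 4 * (1 / sin \<alpha>)"
        using cos sin pi_less_4 by (intro add_mono mult_right_mono) auto
      finally have A: "?A \<le> 4 * S"
        by (simp add: S_def)
      have k: "real k \<le> 2 * log 2 (real n)"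
        using log unfolding k_def by linarith
      have W: "walk ys \<le> 2 * m"
        using walk_Cons_ge[of ys r] ys(3) by linarith
      \<comment> \<open>In units of \<open>S * m * log 2 n\<close> the halving costs twice 16 and
        the radial segment 2, in total 34; dividing by \<open>ln 2\<close> passes to the natural
        logarithm.\<close>
      have "?A * walk ys * real k \<le> (4 * S) * (2 * m) * (2 * log 2 (real n))"
        using S m by (intro mult_mono[OF mult_mono[OF A W] k]) (auto simp: walk_nonneg)
      moreover have "1 / cos \<alpha> * exp (fst w) \<le> S * (2 * m)"
        using wm S sin by (intro mult_mono) (auto simp: S_def)
      moreover have "S * (2 * m) * 1 \<le> S * (2 * m) * log 2 (real n)"
        using log S m by (intro mult_left_mono) auto
      moreover have "34 / ln 2 * S * ln (real n) * m = 34 * S * m * log 2 (real n)"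
        by (simp add: log_def)
      moreover have "(4 * S) * (2 * m) * (2 * log 2 (real n)) = 16 * (S * m * log 2 (real n))"
        "S * (2 * m) * log 2 (real n) = 2 * (S * m * log 2 (real n))"
        "34 * S * m * log 2 (real n) = 34 * (S * m * log 2 (real n))"
        "2 * ?A * walk ys * real k = 2 * (?A * walk ys * real k)"
        by (simp_all only: mult_ac)
      ultimately show ?thesis
        by linarith
    qed
    ultimately show ?thesis
      unfolding S_def m_def by (rule flux_spans_mono)
  qed
qed

theorem mainTheorem4:
  shows "(\<exists>C>0. \<forall>(n::nat) (r::real^2) (t::nat \<Rightarrow> real^2) \<alpha> T M.
            2 \<le> n \<longrightarrow> 0 < \<alpha> \<longrightarrow> \<alpha> < pi / 2 \<longrightarrow>
            optimal_flux_tree r (t ` {1..n}) \<alpha> T \<longrightarrow>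
            minimum_spanning_tree (insert r (t ` {1..n})) M \<longrightarrow>
            flux_length r T \<le> ennreal (C * (1 / cos \<alpha> + 1 / sin \<alpha>) * ln (real n) * edges_length M))
       \<and> (\<forall>(n::nat) (r::real^2) (t::nat \<Rightarrow> real^2) \<alpha> T p d.
            0 < \<alpha> \<longrightarrow> \<alpha> < pi / 2 \<longrightarrow>
            optimal_flux_tree r (t ` {1..n}) \<alpha> T \<longrightarrow>
            has_tree_dist r T p d \<longrightarrow>
            d \<le> ennreal (1 / cos \<alpha> * dist p r))"
proof (intro conjI exI allI impI)
  show "(0::real) < 34 / ln 2"
    by simp
  fix n :: nat and r :: "real^2" and t :: "nat \<Rightarrow> real^2" and \<alpha> T M
  assume "2 \<le> n" "0 < \<alpha>" "\<alpha> < pi / 2"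
    and T: "optimal_flux_tree r (t ` {1..n}) \<alpha> T"
    and M: "minimum_spanning_tree (insert r (t ` {1..n})) M"
  \<comment> \<open>Terminals may coincide, so their number is at most \<open>n\<close>.\<close>
  then have "flux_spans r \<alpha> (t ` {1..n}) (34 / ln 2 * (1 / cos \<alpha> + 1 / sin \<alpha>) * ln (real n) * edges_length M)"
    using card_image_le[of "{1..n}" t]
    by (intro flux_spans_short) (auto simp: minimum_spanning_tree_def)
  \<comment> \<open>An optimal tree is no longer than the tree just constructed.\<close>
  then show "flux_length r T \<le> ennreal (34 / ln 2 * (1 / cos \<alpha> + 1 / sin \<alpha>) * ln (real n) * edges_length M)"
    using T unfolding flux_spans_def optimal_flux_tree_def by (meson order_trans)
next
  fix n :: nat and r :: "real^2" and t :: "nat \<Rightarrow> real^2" and \<alpha> T p d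
  assume "0 < \<alpha>" "\<alpha> < pi / 2" "optimal_flux_tree r (t ` {1..n}) \<alpha> T" "has_tree_dist r T p d"
  then show "d \<le> ennreal (1 / cos \<alpha> * dist p r)"
    using has_tree_dist_le unfolding optimal_flux_tree_def by blast
qed

end
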